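(* Let $\alpha,\beta,\gamma>0$, let $\phi$ and $V_\phi$ be as described in the context, let $0<\rho<(\lim_{x\to\infty}\phi(x))^{\alpha}$, and let $X$ be the random variable with values in $\mathbb{N}=\{0,1,2,\dots\}$ and probability mass function $$\mathbb{P}(X=n)=\frac{\Gamma(n+\gamma)\,\rho^n}{n!\,V_\phi(\alpha n+\beta)}\,\frac{1}{Z_{\alpha,\beta,\gamma}(\rho,\phi)},\qquad n\in\mathbb{N},$$ where, for all $a,b,c>0$, $Z_{a,b,c}(\rho,\phi)=\sum_{k=0}^\infty\frac{\Gamma(k+c)\,\rho^k}{k!\,V_\phi(ak+b)}$. Then $X$ is overdispersed if and only if $$Z_{\alpha,\beta,\gamma}(\rho,\phi)\,Z_{\alpha,2\alpha+\beta,\gamma+2}(\rho,\phi)>Z_{\alpha,\alpha+\beta,\gamma+1}^2(\rho,\phi),$$ and $X$ is underdispersed if and only if $$Z_{\alpha,\beta,\gamma}(\rho,\phi)\,Z_{\alpha,2\alpha+\beta,\gamma+2}(\rho,\phi)<Z_{\alpha,\alpha+\beta,\gamma+1}^2(\rho,\phi).$$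
   Context: The function $\phi:(0,\infty)\to(0,\infty)$ and the associated function $V_\phi:(0,\infty)\to(0,\infty)$ are of one of the following two types. (1) $\phi$ is a Bernstein function, i.e. $\phi\in\mathcal{C}^\infty$, $\phi\ge0$, and $(-1)^{n-1}\phi^{(n)}\ge0$ on $(0,\infty)$ for all integers $n\ge1$, and $V_\phi=W_\phi$ is the Bernstein-gamma function of $\phi$: the unique positive log-convex function on $(0,\infty)$ with $W_\phi(1)=1$ and $W_\phi(x+1)=\phi(x)W_\phi(x)$ for all $x>0$. (2) $\phi$ is eventually log-convex (there is $m\in\mathbb{R}$ such that $\log\phi$ is convex on $(m,\infty)\cap(0,\infty)$) with $\lim_{n\to\infty}\phi(n)/\phi(n+1)=1$, and $V_\phi(x)=\widetilde W_\phi(x)=\lim_{n\to\infty}\frac{\phi(n)\cdots\phi(1)\,(\phi(n))^x}{\phi(n+x)\phi(n-1+x)\cdots\phi(x)}$ for $x>0$; this satisfies $\widetilde W_\phi(1)=1$ and $\widetilde W_\phi(x+1)=\phi(x)\widetilde W_\phi(x)$. The limit $\lim_{x\to\infty}\phi(x)$ may be $+\infty$, in which case $\rho$ is any positive number. A random variable with finite second moment and positive mean is called overdispersed if its variance-to-mean ratio is greater than $1$, and underdispersed if it is less than $1$. *)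

theory Defs
  imports "HOL-Probability.Probability"
begin

definition bernstein_function :: "(real \<Rightarrow> real) \<Rightarrow> bool" where
  "bernstein_function \<phi> \<longleftrightarrow>
     (\<forall>n. \<forall>x>0. (deriv ^^ n) \<phi> differentiable (at x)) \<and>
     (\<forall>x>0. \<phi> x \<ge> 0) \<and>
     (\<forall>n\<ge>1. \<forall>x>0. (-1) ^ (n - 1) * (deriv ^^ n) \<phi> x \<ge> 0)"

text \<open>
  The Bernstein-gamma function is determined only on the open half-line, so it is given by a
  predicate; values of \<^term>\<open>W\<close> at nonpositive arguments are irrelevant.
\<close>

definition bernstein_gamma :: "(real \<Rightarrow> real) \<Rightarrow> (real \<Rightarrow> real) \<Rightarrow> bool" where
  "bernstein_gamma \<phi> W \<longleftrightarrow>
     (\<forall>x>0. W x > 0) \<and>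
     convex_on {0<..} (\<lambda>x. ln (W x)) \<and>
     W 1 = 1 \<and>
     (\<forall>x>0. W (x + 1) = \<phi> x * W x)"

definition eventually_log_convex :: "(real \<Rightarrow> real) \<Rightarrow> bool" where
  "eventually_log_convex \<phi> \<longleftrightarrow> (\<exists>m. convex_on ({m<..} \<inter> {0<..}) (\<lambda>x. ln (\<phi> x)))"

definition W_tilde :: "(real \<Rightarrow> real) \<Rightarrow> real \<Rightarrow> real" where
  "W_tilde \<phi> x =
     lim (\<lambda>n. (\<Prod>k=1..n. \<phi> (real k)) * \<phi> (real n) powr x / (\<Prod>k=0..n. \<phi> (real k + x)))"

definition admissible_pair :: "(real \<Rightarrow> real) \<Rightarrow> (real \<Rightarrow> real) \<Rightarrow> bool" where
  "admissible_pair \<phi> V \<longleftrightarrow>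
     (\<forall>x>0. \<phi> x > 0) \<and>
     (bernstein_function \<phi> \<and> bernstein_gamma \<phi> V \<or>
      eventually_log_convex \<phi> \<and> (\<lambda>n. \<phi> (real n) / \<phi> (real (n + 1))) \<longlonglongrightarrow> 1 \<and>
        (\<forall>x>0. V x = W_tilde \<phi> x))"

text \<open>The second function argument is the associated gamma-type function \<^term>\<open>V\<close>, not \<open>\<phi>\<close>.\<close>

definition Z :: "real \<Rightarrow> real \<Rightarrow> real \<Rightarrow> real \<Rightarrow> (real \<Rightarrow> real) \<Rightarrow> real" where
  "Z a b c \<rho> V = (\<Sum>k. Gamma (real k + c) * \<rho> ^ k / (fact k * V (a * real k + b)))"

definition (in prob_space) overdispersed :: "('a \<Rightarrow> real) \<Rightarrow> bool" where
  "overdispersed X \<longleftrightarrow>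
     random_variable borel X \<and> integrable M (\<lambda>\<omega>. (X \<omega>)\<^sup>2) \<and> expectation X > 0 \<and>
     variance X / expectation X > 1"

definition (in prob_space) underdispersed :: "('a \<Rightarrow> real) \<Rightarrow> bool" where
  "underdispersed X \<longleftrightarrow>
     random_variable borel X \<and> integrable M (\<lambda>\<omega>. (X \<omega>)\<^sup>2) \<and> expectation X > 0 \<and>
     variance X / expectation X < 1"

end

theory Submission
  imports Defs "HOL-Real_Asymp.Real_Asymp"
begin

text \<open>
  Write \<open>t n\<close> for the unnormalized mass at \<open>n\<close>. Cancelling factors of \<open>n!\<close> shows that
  \<open>n * t n\<close> and \<open>n * (n - 1) * t n\<close> are, up to factors \<open>\<rho>\<close> and \<open>\<rho>\<^sup>2\<close>, the terms of the series \<open>Z\<close>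
  with \<open>(\<beta>, \<gamma>)\<close> replaced by \<open>(\<alpha> + \<beta>, \<gamma> + 1)\<close> and \<open>(2 * \<alpha> + \<beta>, \<gamma> + 2)\<close>. With \<open>Z0\<close>, \<open>Z1\<close>, \<open>Z2\<close> the
  sums of the three series, \<open>E X = \<rho> * Z1 / Z0\<close> and \<open>E (X * (X - 1)) = \<rho>\<^sup>2 * Z2 / Z0\<close>, hence
  \<open>Var X - E X = E (X * (X - 1)) - (E X)\<^sup>2 = (\<rho> / Z0)\<^sup>2 * (Z0 * Z2 - Z1\<^sup>2)\<close>,
  and the sign of the last factor decides between over- and underdispersion.

  The analytic content is that the three series converge and have positive terms, so that the
  second moment exists and the mean is positive. The ratio test reduces convergence to
  the growth estimate \<open>V (x + \<alpha>) \<ge> l\<^sup>\<alpha> * V x\<close> for large \<open>x\<close>, for some \<open>l\<close> with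
  \<open>\<rho> < l\<^sup>\<alpha>\<close> that is eventually a lower bound of \<open>\<phi>\<close>; such an \<open>l\<close> exists because \<open>\<rho>\<close> is less
  than the \<open>\<alpha>\<close>-th power of the limit of \<open>\<phi>\<close> (lemma \<open>ex_lower_bound_above_root\<close>). For
  Bernstein-gamma functions the estimate is monotonicity of the slopes of \<open>ln V\<close> (lemma
  \<open>bernstein_gamma_growth\<close>). In the eventually log-convex case \<open>\<phi>\<close> turns out to be
  eventually nonincreasing, from which follow the existence and positivity of the limit defining
  \<open>W_tilde\<close> as well as the estimate, already for its approximants (lemma \<open>W_tilde_growth\<close>).
\<close>

section \<open>Growth of the gamma-type function\<close>

lemma convex_on_chord_le:
  fixes f :: "real \<Rightarrow> real"
  assumes "convex_on I f" "x \<in> I" "y \<in> I" "x < t" "t < y"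
  shows "(f t - f x) / (t - x) \<le> (f y - f t) / (y - t)"
proof -
  have "(f x - f t) / (x - t) \<le> (f t - f y) / (t - y)"
    using convex_on_slope_le[OF assms] by linarith
  moreover have "(f x - f t) / (x - t) = (f t - f x) / (t - x)"
    "(f t - f y) / (t - y) = (f y - f t) / (y - t)"
    by (metis minus_diff_eq minus_divide_divide)+
  ultimately show ?thesis by simp
qed

text \<open>
  The slope of the convex function \<open>ln V\<close> over \<open>[x, x + \<alpha>]\<close> is at least its slope over
  \<open>[x - 1, x]\<close>, and the latter is \<open>ln (\<phi> (x - 1))\<close> by the functional equation.
\<close>

lemma bernstein_gamma_growth:
  assumes V: "bernstein_gamma \<phi> V" and \<phi>: "\<And>x. x > 0 \<Longrightarrow> \<phi> x > 0" and "\<alpha> > 0" "l > 0"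
    and ev: "eventually (\<lambda>x. l \<le> \<phi> x) at_top"
  shows "eventually (\<lambda>x. l powr \<alpha> * V x \<le> V (x + \<alpha>)) at_top"
proof -
  from ev obtain B where B: "\<And>x. x \<ge> B \<Longrightarrow> l \<le> \<phi> x" by (auto simp: eventually_at_top_linorder)
  have pos: "V x > 0" if "x > 0" for x using V that by (auto simp: bernstein_gamma_def)
  have "l powr \<alpha> * V x \<le> V (x + \<alpha>)" if x: "x > 1" "x \<ge> B + 1" for x
  proof -
    have "convex_on {0<..} (\<lambda>x. ln (V x))" using V by (simp add: bernstein_gamma_def)
    from convex_on_chord_le[OF this, of "x - 1" "x + \<alpha>" x]
    have 1: "ln (V x) - ln (V (x - 1)) \<le> (ln (V (x + \<alpha>)) - ln (V x)) / \<alpha>"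
      using x \<open>\<alpha> > 0\<close> by simp
    have "V (x - 1 + 1) = \<phi> (x - 1) * V (x - 1)"
      using V x unfolding bernstein_gamma_def by (metis diff_gt_0_iff_gt)
    hence "ln (V x) - ln (V (x - 1)) = ln (\<phi> (x - 1))"
      using x pos[of "x - 1"] \<phi>[of "x - 1"] by (simp add: ln_mult)
    moreover have "ln l \<le> ln (\<phi> (x - 1))" using B[of "x - 1"] x \<open>l > 0\<close> by simp
    ultimately have "ln l \<le> (ln (V (x + \<alpha>)) - ln (V x)) / \<alpha>" using 1 by linarith
    hence "\<alpha> * ln l \<le> ln (V (x + \<alpha>)) - ln (V x)"
      using \<open>\<alpha> > 0\<close> by (simp add: pos_le_divide_eq mult.commute)
    hence "\<alpha> * ln l + ln (V x) \<le> ln (V (x + \<alpha>))" by simp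
    hence "exp (\<alpha> * ln l + ln (V x)) \<le> exp (ln (V (x + \<alpha>)))" by simp
    thus ?thesis using pos[of x] pos[of "x + \<alpha>"] x \<open>\<alpha> > 0\<close> \<open>l > 0\<close>
      by (simp add: exp_add powr_def)
  qed
  thus ?thesis unfolding eventually_at_top_linorder
    by (intro exI[of _ "max 2 (B + 1)"]) auto
qed

text \<open>
  The logarithm of the sequence whose limit is \<open>W_tilde\<close>; the additive form makes its
  increments and its dependence on \<open>x\<close> accessible to convexity of \<open>ln \<circ> \<phi>\<close>.
\<close>

definition ln_W_approx :: "(real \<Rightarrow> real) \<Rightarrow> nat \<Rightarrow> real \<Rightarrow> real" where
  "ln_W_approx \<phi> n x =
     (\<Sum>k=1..n. ln (\<phi> (real k))) + x * ln (\<phi> (real n)) - (\<Sum>k=0..n. ln (\<phi> (real k + x)))"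

lemma exp_ln_W_approx:
  assumes \<phi>: "\<And>x. x > 0 \<Longrightarrow> \<phi> x > 0" and "x > 0" "n > 0"
  shows "(\<Prod>k=1..n. \<phi> (real k)) * \<phi> (real n) powr x / (\<Prod>k=0..n. \<phi> (real k + x)) =
    exp (ln_W_approx \<phi> n x)"
proof -
  have "(\<Prod>k=1..n. exp (ln (\<phi> (real k)))) = (\<Prod>k=1..n. \<phi> (real k))"
    by (intro prod.cong) (auto simp: \<phi>)
  moreover have "(\<Prod>k=0..n. exp (ln (\<phi> (real k + x)))) = (\<Prod>k=0..n. \<phi> (real k + x))"
    using \<open>x > 0\<close> by (intro prod.cong) (auto simp: \<phi> add_nonneg_pos)
  moreover have "\<phi> (real n) powr x = exp (x * ln (\<phi> (real n)))"
    using \<phi>[of "real n"] \<open>n > 0\<close> by (simp add: powr_def)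
  ultimately show ?thesis
    by (simp add: ln_W_approx_def exp_add exp_diff exp_sum)
qed

lemma ln_W_approx_Suc:
  "ln_W_approx \<phi> (Suc n) x = ln_W_approx \<phi> n x
     + (ln (\<phi> (real n + 1)) + x * (ln (\<phi> (real n + 1)) - ln (\<phi> (real n))) - ln (\<phi> (real n + 1 + x)))"
proof -
  have Suc_n: "real (Suc n) = real n + 1" by simp
  show ?thesis
    unfolding ln_W_approx_def sum.cl_ivl_Suc
    by (simp only: Suc_n) (simp add: right_diff_distrib)
qed

text \<open>
  Every chord of \<open>ln \<circ> \<phi>\<close> has slope at most that of the chords over \<open>[n, n + 1]\<close> further to the
  right. The latter tend to \<open>0\<close> because the ratios of consecutive values tend to \<open>1\<close>, so no
  chord has positive slope.
\<close>

lemma eventually_log_convex_antimono: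
  assumes \<phi>: "\<And>x. x > 0 \<Longrightarrow> \<phi> x > 0" and conv: "convex_on {m<..} (\<lambda>x. ln (\<phi> x))" and m: "m \<ge> 0"
    and lim: "(\<lambda>n. \<phi> (real n) / \<phi> (real (n + 1))) \<longlonglongrightarrow> 1"
    and uv: "m < u" "u \<le> v"
  shows "ln (\<phi> v) \<le> ln (\<phi> u)"
proof (cases "u = v")
  case False
  define g where "g = (\<lambda>x. ln (\<phi> x))"
  have "(\<lambda>n. - ln (\<phi> (real n) / \<phi> (real (n + 1)))) \<longlonglongrightarrow> - ln 1"
    by (intro tendsto_intros lim) auto
  hence lim': "(\<lambda>n. - ln (\<phi> (real n) / \<phi> (real (n + 1)))) \<longlonglongrightarrow> 0" by simp
  have "eventually (\<lambda>n. (g v - g u) / (v - u) \<le> - ln (\<phi> (real n) / \<phi> (real (n + 1)))) sequentially"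
    using eventually_gt_at_top[of "nat \<lceil>v\<rceil>"]
  proof eventually_elim
    case (elim n)
    hence n: "v < real n" by linarith
    have c: "convex_on {m<..} g" using conv by (simp add: g_def)
    have "(g v - g u) / (v - u) \<le> (g (real n) - g v) / (real n - v)"
      using convex_on_chord_le[OF c, of u "real n" v] uv False n by auto
    also have "\<dots> \<le> (g (real n + 1) - g (real n)) / (real n + 1 - real n)"
      using convex_on_chord_le[OF c, of v "real n + 1" "real n"] uv n by auto
    also have "\<dots> = - ln (\<phi> (real n) / \<phi> (real (n + 1)))"
      using \<phi>[of "real n"] \<phi>[of "real n + 1"] n m uv by (simp add: g_def ln_div add.commute)
    finally show ?case .
  qed
  hence "(g v - g u) / (v - u) \<le> 0" by (intro tendsto_lowerbound[OF lim']) auto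
  thus ?thesis using uv False by (simp add: g_def field_simps split: if_splits)
qed simp

text \<open>
  From some index on the sequence is monotone and bounded. Convexity on
  \<open>n < n + 1 < n + 1 + x\<close> makes its increments nonpositive. Since \<open>ln \<circ> \<phi>\<close> is
  nonincreasing, each increment is at least \<open>x\<close> times the increment of \<open>ln \<circ> \<phi>\<close>; these bounds
  telescope, and \<open>ln \<circ> \<phi>\<close> is bounded below by \<open>ln l\<close>.
\<close>

lemma ln_W_approx_convergent:
  assumes \<phi>: "\<And>x. x > 0 \<Longrightarrow> \<phi> x > 0" and conv: "convex_on {m<..} (\<lambda>x. ln (\<phi> x))" and m: "m \<ge> 0"
    and lim: "(\<lambda>n. \<phi> (real n) / \<phi> (real (n + 1))) \<longlonglongrightarrow> 1"
    and l: "l > 0" "eventually (\<lambda>x. l \<le> \<phi> x) at_top" and x: "x > 0"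
  shows "convergent (\<lambda>n. ln_W_approx \<phi> n x)"
proof -
  note antimono = eventually_log_convex_antimono[OF \<phi> conv m lim]
  from l obtain B where B: "\<And>x. x \<ge> B \<Longrightarrow> l \<le> \<phi> x" by (auto simp: eventually_at_top_linorder)
  define N where "N = nat \<lceil>max m B\<rceil> + 1"
  have N: "real n > m" "real n \<ge> B" if "n \<ge> N" for n
    using that unfolding N_def by linarith+
  define c where "c = (\<lambda>i. ln_W_approx \<phi> (i + N) x)"
  have dec: "decseq c"
  proof (rule decseq_SucI)
    fix i
    let ?n = "real (i + N)"
    have "(ln (\<phi> (?n + 1)) - ln (\<phi> ?n)) / (?n + 1 - ?n)
        \<le> (ln (\<phi> (?n + 1 + x)) - ln (\<phi> (?n + 1))) / (?n + 1 + x - (?n + 1))"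
      using convex_on_chord_le[OF conv, of ?n "?n + 1 + x" "?n + 1"] N[of "i + N"] x by auto
    hence "x * (ln (\<phi> (?n + 1)) - ln (\<phi> ?n)) \<le> ln (\<phi> (?n + 1 + x)) - ln (\<phi> (?n + 1))"
      using x by (simp add: field_simps)
    thus "c (Suc i) \<le> c i"
      unfolding c_def using ln_W_approx_Suc[of \<phi> "i + N" x] by simp
  qed
  have low: "c 0 + x * (ln (\<phi> (real (i + N))) - ln (\<phi> (real N))) \<le> c i" for i
  proof (induction i)
    case (Suc i)
    have "ln (\<phi> (real (i + N) + 1 + x)) \<le> ln (\<phi> (real (i + N) + 1))"
      using N[of "i + N"] x by (intro antimono) auto
    with Suc show ?case
      unfolding c_def using ln_W_approx_Suc[of \<phi> "i + N" x] by (simp add: algebra_simps)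
  qed (simp add: c_def)
  have "c 0 + x * (ln l - ln (\<phi> (real N))) \<le> c i" for i
  proof -
    have "ln l \<le> ln (\<phi> (real (i + N)))"
      using B[OF N(2)[of "i + N"]] l(1) by simp
    hence "x * ln l \<le> x * ln (\<phi> (real (i + N)))" using x by simp
    with low[of i] show ?thesis by (simp add: algebra_simps)
  qed
  with decseq_convergent[OF dec] have "convergent c" unfolding convergent_def by metis
  thus ?thesis unfolding c_def by (subst (asm) convergent_ignore_initial_segment)
qed

lemma W_tilde_eq:
  assumes \<phi>: "\<And>x. x > 0 \<Longrightarrow> \<phi> x > 0" and x: "x > 0"
    and a: "(\<lambda>n. ln_W_approx \<phi> n x) \<longlonglongrightarrow> a"
  shows "W_tilde \<phi> x = exp a"
proof -
  have "(\<lambda>n. exp (ln_W_approx \<phi> n x)) \<longlonglongrightarrow> exp a" by (intro tendsto_intros a)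
  moreover have "eventually (\<lambda>n. exp (ln_W_approx \<phi> n x) =
      (\<Prod>k=1..n. \<phi> (real k)) * \<phi> (real n) powr x / (\<Prod>k=0..n. \<phi> (real k + x))) sequentially"
    using eventually_gt_at_top[of 0] by eventually_elim (use exp_ln_W_approx[of \<phi> x] \<phi> x in simp)
  ultimately show ?thesis
    unfolding W_tilde_def by (intro limI) (rule Lim_transform_eventually)
qed

text \<open>
  Positivity holds because \<open>W_tilde\<close> is the exponential of a finite limit. For the growth estimate
  compare the approximants at \<open>x\<close> and \<open>x + \<alpha>\<close>: the sums over \<open>k\<close> can only favour
  \<open>x + \<alpha>\<close>, as \<open>\<phi>\<close> is nonincreasing there, and what remains is \<open>\<alpha> * ln (\<phi> n)\<close>.
\<close>

lemma W_tilde_growth: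
  assumes \<phi>: "\<And>x. x > 0 \<Longrightarrow> \<phi> x > 0" and conv: "eventually_log_convex \<phi>"
    and lim: "(\<lambda>n. \<phi> (real n) / \<phi> (real (n + 1))) \<longlonglongrightarrow> 1" and "\<alpha> > 0"
    and l: "l > 0" "eventually (\<lambda>x. l \<le> \<phi> x) at_top"
  shows "\<And>x. x > 0 \<Longrightarrow> W_tilde \<phi> x > 0"
    and "eventually (\<lambda>x. l powr \<alpha> * W_tilde \<phi> x \<le> W_tilde \<phi> (x + \<alpha>)) at_top"
proof -
  from conv obtain m' where "convex_on ({m'<..} \<inter> {0<..}) (\<lambda>x. ln (\<phi> x))"
    by (auto simp: eventually_log_convex_def)
  \<comment> \<open>Enlarging the threshold to a nonnegative one turns the domain of convexity into a half-line.\<close>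
  moreover define m where "m = max m' 0"
  moreover have "{m'<..} \<inter> {0<..} = {m<..}" by (auto simp: m_def)
  ultimately have conv': "convex_on {m<..} (\<lambda>x. ln (\<phi> x))" and m: "m \<ge> 0" by auto
  have ex: "\<exists>a. (\<lambda>n. ln_W_approx \<phi> n x) \<longlonglongrightarrow> a" if "x > 0" for x
    using ln_W_approx_convergent[OF \<phi> conv' m lim l that] by (auto simp: convergent_def)
  show "W_tilde \<phi> x > 0" if "x > 0" for x
    using ex[OF that] W_tilde_eq[OF \<phi> that] by auto
  from l obtain B where B: "\<And>x. x \<ge> B \<Longrightarrow> l \<le> \<phi> x" by (auto simp: eventually_at_top_linorder)
  have "l powr \<alpha> * W_tilde \<phi> x \<le> W_tilde \<phi> (x + \<alpha>)" if x: "x > m" for x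
  proof -
    have x0: "x > 0" "x + \<alpha> > 0" using x m \<open>\<alpha> > 0\<close> by auto
    from ex[OF x0(1)] obtain a where a: "(\<lambda>n. ln_W_approx \<phi> n x) \<longlonglongrightarrow> a" by blast
    from ex[OF x0(2)] obtain b where b: "(\<lambda>n. ln_W_approx \<phi> n (x + \<alpha>)) \<longlonglongrightarrow> b" by blast
    have "eventually (\<lambda>n. \<alpha> * ln l \<le> ln_W_approx \<phi> n (x + \<alpha>) - ln_W_approx \<phi> n x) sequentially"
      using eventually_ge_at_top[of "nat \<lceil>B\<rceil>"]
    proof eventually_elim
      case (elim n)
      have "ln l \<le> ln (\<phi> (real n))" using B[of "real n"] elim l(1) by simp
      hence "\<alpha> * ln l \<le> \<alpha> * ln (\<phi> (real n))" using \<open>\<alpha> > 0\<close> by simp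
      moreover have "(\<Sum>k=0..n. ln (\<phi> (real k + (x + \<alpha>)))) \<le> (\<Sum>k=0..n. ln (\<phi> (real k + x)))"
        using x \<open>\<alpha> > 0\<close>
        by (intro sum_mono eventually_log_convex_antimono[OF \<phi> conv' m lim]) auto
      ultimately show ?case by (simp add: ln_W_approx_def algebra_simps)
    qed
    hence "\<alpha> * ln l \<le> b - a"
      by (intro tendsto_lowerbound[OF tendsto_diff[OF b a]]) auto
    hence "exp (\<alpha> * ln l + a) \<le> exp b" by simp
    thus ?thesis using W_tilde_eq[OF \<phi> x0(1) a] W_tilde_eq[OF \<phi> x0(2) b] l(1)
      by (simp add: exp_add powr_def)
  qed
  thus "eventually (\<lambda>x. l powr \<alpha> * W_tilde \<phi> x \<le> W_tilde \<phi> (x + \<alpha>)) at_top"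
    using eventually_gt_at_top[of m] by (rule eventually_mono[rotated])
qed

lemma admissible_pair_growth:
  assumes adm: "admissible_pair \<phi> V" and "\<alpha> > 0"
    and l: "l > 0" "eventually (\<lambda>x. l \<le> \<phi> x) at_top"
  shows "\<And>x. x > 0 \<Longrightarrow> V x > 0"
    and "eventually (\<lambda>x. l powr \<alpha> * V x \<le> V (x + \<alpha>)) at_top"
proof -
  have \<phi>: "\<phi> x > 0" if "x > 0" for x using adm that by (simp add: admissible_pair_def)
  from adm consider "bernstein_gamma \<phi> V"
    | "eventually_log_convex \<phi>" "(\<lambda>n. \<phi> (real n) / \<phi> (real (n + 1))) \<longlonglongrightarrow> 1"
      "\<And>x. x > 0 \<Longrightarrow> V x = W_tilde \<phi> x"
    unfolding admissible_pair_def by blast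
  hence "(\<forall>x>0. V x > 0) \<and> eventually (\<lambda>x. l powr \<alpha> * V x \<le> V (x + \<alpha>)) at_top"
  proof cases
    case 1
    thus ?thesis using bernstein_gamma_growth[OF 1 \<phi> \<open>\<alpha> > 0\<close> l] by (auto simp: bernstein_gamma_def)
  next
    case 2
    have W: "\<And>x. x > 0 \<Longrightarrow> W_tilde \<phi> x > 0"
      "eventually (\<lambda>x. l powr \<alpha> * W_tilde \<phi> x \<le> W_tilde \<phi> (x + \<alpha>)) at_top"
      using W_tilde_growth[OF _ 2(1,2) \<open>\<alpha> > 0\<close> l] \<phi> by blast+
    have "eventually (\<lambda>x. l powr \<alpha> * V x \<le> V (x + \<alpha>)) at_top"
      using W(2) eventually_gt_at_top[of 0]
      by eventually_elim (use 2(3) \<open>\<alpha> > 0\<close> in auto)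
    thus ?thesis using W(1) 2(3) by auto
  qed
  thus "\<And>x. x > 0 \<Longrightarrow> V x > 0" "eventually (\<lambda>x. l powr \<alpha> * V x \<le> V (x + \<alpha>)) at_top" by auto
qed

text \<open>
  Any \<open>l\<close> strictly between \<open>\<rho> powr (1 / \<alpha>)\<close> and \<open>L\<close> works. A zero limit is excluded by the
  hypothesis on \<open>\<rho>\<close>, since \<open>0 powr \<alpha> = 0\<close>.
\<close>

lemma ex_lower_bound_above_root:
  fixes \<phi> :: "real \<Rightarrow> real"
  assumes L: "((\<lambda>x. ereal (\<phi> x)) \<longlongrightarrow> L) at_top" and "\<alpha> > 0"
    and \<rho>: "0 < \<rho>" "L \<noteq> \<infinity> \<longrightarrow> \<rho> < real_of_ereal L powr \<alpha>" and \<phi>: "\<And>x. x > 0 \<Longrightarrow> \<phi> x > 0"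
  obtains l where "l > 0" "\<rho> < l powr \<alpha>" "eventually (\<lambda>x. l \<le> \<phi> x) at_top"
proof -
  have "eventually (\<lambda>x. 0 \<le> ereal (\<phi> x)) at_top"
    using eventually_gt_at_top[of 0] by eventually_elim (simp add: \<phi> less_imp_le)
  from tendsto_lowerbound[OF L this] have "0 \<le> L" by simp
  have "ereal (\<rho> powr (1 / \<alpha>)) < L"
  proof (cases "L = \<infinity>")
    case False
    with \<open>0 \<le> L\<close> obtain r where r: "L = ereal r" "r \<ge> 0" by (cases L) auto
    with False \<rho> have "\<rho> < r powr \<alpha>" by simp
    hence "\<rho> powr (1 / \<alpha>) < (r powr \<alpha>) powr (1 / \<alpha>)"
      using \<rho>(1) \<open>\<alpha> > 0\<close> by (intro powr_less_mono2) auto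
    thus ?thesis using r \<open>\<alpha> > 0\<close> by (simp add: powr_powr)
  qed simp
  then obtain l where l: "ereal (\<rho> powr (1 / \<alpha>)) < ereal l" "ereal l < L"
    using ereal_dense2 by metis
  have "\<rho> powr (1 / \<alpha>) > 0" using \<rho>(1) by simp
  moreover have "\<rho> powr (1 / \<alpha>) < l" using l(1) by simp
  ultimately have "l > 0" by linarith
  have "(\<rho> powr (1 / \<alpha>)) powr \<alpha> < l powr \<alpha>"
    using l \<open>\<alpha> > 0\<close> by (intro powr_less_mono2) auto
  hence "\<rho> < l powr \<alpha>" using \<rho>(1) \<open>\<alpha> > 0\<close> by (simp add: powr_powr)
  moreover have "eventually (\<lambda>x. l \<le> \<phi> x) at_top"
    using order_tendstoD(1)[OF L l(2)] by eventually_elim simp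
  ultimately show ?thesis using that \<open>l > 0\<close> by blast
qed

section \<open>The terms of the normalizing series\<close>

definition Z_term :: "real \<Rightarrow> real \<Rightarrow> real \<Rightarrow> real \<Rightarrow> (real \<Rightarrow> real) \<Rightarrow> nat \<Rightarrow> real" where
  "Z_term a b c \<rho> V k = Gamma (real k + c) * \<rho> ^ k / (fact k * V (a * real k + b))"

lemma Z_eq_suminf: "Z a b c \<rho> V = (\<Sum>k. Z_term a b c \<rho> V k)"
  by (simp add: Z_def Z_term_def)

lemma Z_term_pos:
  assumes "\<And>x. x > 0 \<Longrightarrow> V x > 0" "a > 0" "b > 0" "c > 0" "\<rho> > 0"
  shows "Z_term a b c \<rho> V k > 0"
  unfolding Z_term_def using assms
  by (intro divide_pos_pos mult_pos_pos Gamma_real_pos assms(1) add_nonneg_pos) auto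

text \<open>
  This shift is the reason why factorial moments of the distribution are again values of \<open>Z\<close>.
\<close>

lemma Suc_mult_Z_term_Suc:
  "real (Suc k) * Z_term a b c \<rho> V (Suc k) = \<rho> * Z_term a (a + b) (c + 1) \<rho> V k"
proof -
  have "real (Suc k) + c = real k + (c + 1)" "a * real (Suc k) + b = a * real k + (a + b)"
    by (simp_all add: algebra_simps)
  thus ?thesis unfolding Z_term_def by (simp only: fact_Suc) (simp del: of_nat_Suc)
qed

text \<open>
  Ratio test: the quotient of consecutive terms is
  \<open>(k + c) / (k + 1) * (\<rho> * V (a * k + b) / V (a * k + b + a))\<close>, and the growth hypothesis
  bounds it by something that tends to \<open>\<rho> / K < 1\<close>.
\<close>

lemma summable_Z_term:
  assumes V: "\<And>x. x > 0 \<Longrightarrow> V x > 0" and pos: "a > 0" "b > 0" "c > 0" "\<rho> > 0"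
    and K: "\<rho> < K" "eventually (\<lambda>x. K * V x \<le> V (x + a)) at_top"
  shows "summable (Z_term a b c \<rho> V)"
proof -
  have t: "Z_term a b c \<rho> V k > 0" for k using V pos by (intro Z_term_pos) auto
  have "K > 0" using K(1) pos by simp
  obtain q where q: "\<rho> / K < q" "q < 1" using dense[of "\<rho> / K" 1] K(1) \<open>K > 0\<close> by auto
  have "filterlim (\<lambda>k. a * real k + b) at_top sequentially"
    using pos(1) by real_asymp
  from eventually_compose_filterlim[OF K(2) this]
  have ev1: "eventually (\<lambda>k. K * V (a * real k + b) \<le> V (a * real k + b + a)) sequentially" .
  have "(\<lambda>k. (real k + c) / (real k + 1) * (\<rho> / K)) \<longlonglongrightarrow> 1 * (\<rho> / K)"
    by (intro tendsto_mult tendsto_const) real_asymp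
  hence ev2: "eventually (\<lambda>k. (real k + c) / (real k + 1) * (\<rho> / K) < q) sequentially"
    using q by (intro order_tendstoD(2)) auto
  have "eventually (\<lambda>k. norm (Z_term a b c \<rho> V (Suc k)) \<le> q * norm (Z_term a b c \<rho> V k)) sequentially"
    using ev1 ev2
  proof eventually_elim
    case (elim k)
    let ?v = "V (a * real k + b)" and ?w = "V (a * real k + b + a)"
    have v: "?v > 0" "?w > 0"
      using pos by (auto intro!: V simp: add_nonneg_pos add_pos_pos)
    have G: "Gamma (real k + c + 1) = (real k + c) * Gamma (real k + c)"
      using pos by (intro Gamma_plus1) (auto elim!: nonpos_Ints_cases)
    have "Z_term a b c \<rho> V (Suc k) = Z_term a b c \<rho> V k * ((real k + c) / (real k + 1) * (\<rho> * ?v / ?w))"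
    proof -
      have eqs: "real k + 1 + c = real k + c + 1" "a * (real k + 1) + b = a * real k + b + a"
        "real (Suc k) = real k + 1" by (simp_all add: algebra_simps)
      have "A * G * (\<rho> * P) / (B * F * w) = G * P / (F * v) * (A / B * (\<rho> * v / w))"
        if "v \<noteq> 0" for A B F G P v w :: real
        using that by (simp add: mult_ac)
      from this[of ?v] show ?thesis
        using v unfolding Z_term_def fact_Suc power_Suc of_nat_mult eqs G by simp
    qed
    also have "\<dots> \<le> Z_term a b c \<rho> V k * ((real k + c) / (real k + 1) * (\<rho> / K))"
    proof (intro mult_left_mono)
      show "\<rho> * ?v / ?w \<le> \<rho> / K" using elim(1) v \<open>K > 0\<close> pos(4) by (simp add: field_simps)
    qed (use pos less_imp_le[OF t] in auto)
    also have "\<dots> \<le> Z_term a b c \<rho> V k * q"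
      using elim(2) less_imp_le[OF t] by (intro mult_left_mono) auto
    finally show ?case using t[of k] t[of "Suc k"] by (simp add: mult.commute)
  qed
  then obtain N where "\<And>k. k \<ge> N \<Longrightarrow> norm (Z_term a b c \<rho> V (Suc k)) \<le> q * norm (Z_term a b c \<rho> V k)"
    by (auto simp: eventually_sequentially)
  thus ?thesis using q(2) by (rule summable_ratio_test[rotated])
qed

text \<open>
  One shift of the index gives the first moment, two shifts the second factorial moment; the second
  moment is their sum because \<open>n\<^sup>2 = n * (n - 1) + n\<close>.
\<close>

lemma Z_term_moment_sums:
  assumes sum0: "summable (Z_term a b c \<rho> V)"
    and sum1: "summable (Z_term a (a + b) (c + 1) \<rho> V)"
    and sum2: "summable (Z_term a (2 * a + b) (c + 2) \<rho> V)"
  shows "(\<lambda>n. real n * Z_term a b c \<rho> V n) sums (\<rho> * Z a (a + b) (c + 1) \<rho> V)"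
    and "(\<lambda>n. (real n)\<^sup>2 * Z_term a b c \<rho> V n) sums
      (\<rho>\<^sup>2 * Z a (2 * a + b) (c + 2) \<rho> V + \<rho> * Z a (a + b) (c + 1) \<rho> V)"
proof -
  let ?t = "Z_term a b c \<rho> V"
  have "(\<lambda>n. real (Suc n) * ?t (Suc n)) sums (\<rho> * Z a (a + b) (c + 1) \<rho> V)"
    unfolding Suc_mult_Z_term_Suc Z_eq_suminf by (intro sums_mult summable_sums sum1)
  from sums_Suc[OF this] show 1: "(\<lambda>n. real n * ?t n) sums (\<rho> * Z a (a + b) (c + 1) \<rho> V)" by simp
  have eq: "real (Suc (Suc n)) * (real (Suc (Suc n)) - 1) * ?t (Suc (Suc n)) =
      \<rho>\<^sup>2 * Z_term a (2 * a + b) (c + 2) \<rho> V n" for n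
  proof -
    have "real (Suc (Suc n)) * (real (Suc (Suc n)) - 1) * ?t (Suc (Suc n)) =
        real (Suc n) * (real (Suc (Suc n)) * ?t (Suc (Suc n)))" by simp
    also have "\<dots> = \<rho> * (real (Suc n) * Z_term a (a + b) (c + 1) \<rho> V (Suc n))"
      by (subst Suc_mult_Z_term_Suc) (rule mult.left_commute)
    also have "\<dots> = \<rho>\<^sup>2 * Z_term a (a + (a + b)) (c + 1 + 1) \<rho> V n"
      by (subst Suc_mult_Z_term_Suc) (simp add: power2_eq_square)
    also have "a + (a + b) = 2 * a + b" by simp
    also have "c + 1 + 1 = c + 2" by simp
    finally show ?thesis .
  qed
  have "(\<lambda>n. real (Suc (Suc n)) * (real (Suc (Suc n)) - 1) * ?t (Suc (Suc n))) sums
      (\<rho>\<^sup>2 * Z a (2 * a + b) (c + 2) \<rho> V)"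
    unfolding eq Z_eq_suminf by (intro sums_mult summable_sums sum2)
  \<comment> \<open>The two restored terms vanish: \<open>n * (n - 1) = 0\<close> for \<open>n = 0\<close> and \<open>n = 1\<close>.\<close>
  from sums_Suc[OF sums_Suc[OF this]]
  have 2: "(\<lambda>n. real n * (real n - 1) * ?t n) sums (\<rho>\<^sup>2 * Z a (2 * a + b) (c + 2) \<rho> V)" by simp
  show "(\<lambda>n. (real n)\<^sup>2 * ?t n) sums
      (\<rho>\<^sup>2 * Z a (2 * a + b) (c + 2) \<rho> V + \<rho> * Z a (a + b) (c + 1) \<rho> V)"
    using sums_add[OF 2 1] by (simp add: algebra_simps power2_eq_square)
qed

section \<open>Dispersion and factorial moments\<close>

text \<open>
  The distribution of \<open>X\<close> has its probability mass function as density with respect to counting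
  measure, so expectations become sums.
\<close>

lemma (in prob_space) expectation_nat_valued:
  fixes X :: "'a \<Rightarrow> nat" and f :: "nat \<Rightarrow> real"
  assumes X: "X \<in> measurable M (count_space UNIV)"
    and f: "\<And>n. f n \<ge> 0" "(\<lambda>n. f n * prob {\<omega> \<in> space M. X \<omega> = n}) sums s"
  shows "integrable M (\<lambda>\<omega>. f (X \<omega>))" "expectation (\<lambda>\<omega>. f (X \<omega>)) = s"
proof -
  define p where "p n = prob {\<omega> \<in> space M. X \<omega> = n}" for n
  have p0: "p n \<ge> 0" for n by (simp add: p_def)
  have distr: "distr M (count_space UNIV) X = density (count_space UNIV) (\<lambda>n. ennreal (p n))"
  proof (rule measure_eqI_countable[of _ UNIV])
    fix n :: nat
    have "emeasure (distr M (count_space UNIV) X) {n} = emeasure M (X -` {n} \<inter> space M)"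
      using X by (simp add: emeasure_distr)
    also have "X -` {n} \<inter> space M = {\<omega> \<in> space M. X \<omega> = n}" by auto
    finally show "emeasure (distr M (count_space UNIV) X) {n} =
        emeasure (density (count_space UNIV) (\<lambda>n. ennreal (p n))) {n}"
      by (simp add: p_def emeasure_eq_measure emeasure_density nn_integral_count_space_indicator[symmetric]
          nn_integral_count_space_finite)
  qed auto
  have "summable (\<lambda>n. norm (p n * f n))"
    using f p0 by (simp add: p_def[symmetric] sums_iff mult.commute)
  hence int: "integrable (count_space UNIV) (\<lambda>n. p n * f n)"
    by (simp add: integrable_count_space_nat_iff)
  have "integrable (distr M (count_space UNIV) X) f"
    unfolding distr using int p0 by (subst integrable_density) auto
  thus "integrable M (\<lambda>\<omega>. f (X \<omega>))"
    using X by (subst (asm) integrable_distr_eq) auto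
  have "expectation (\<lambda>\<omega>. f (X \<omega>)) = integral\<^sup>L (distr M (count_space UNIV) X) f"
    using X by (subst integral_distr) auto
  also have "\<dots> = (\<Sum>n. p n * f n)"
    unfolding distr using int p0 by (subst integral_density) (auto simp: integral_count_space_nat)
  also have "\<dots> = s" using f(2) by (simp add: p_def[symmetric] sums_iff mult.commute)
  finally show "expectation (\<lambda>\<omega>. f (X \<omega>)) = s" .
qed

lemma (in prob_space) dispersion_iff_moments:
  assumes "integrable M X" "integrable M (\<lambda>\<omega>. (X \<omega>)\<^sup>2)" "expectation X > 0"
  shows "overdispersed X \<longleftrightarrow> expectation (\<lambda>\<omega>. (X \<omega>)\<^sup>2) - expectation X > (expectation X)\<^sup>2"
    and "underdispersed X \<longleftrightarrow> expectation (\<lambda>\<omega>. (X \<omega>)\<^sup>2) - expectation X < (expectation X)\<^sup>2"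
proof -
  have "variance X / expectation X > 1 \<longleftrightarrow> variance X > expectation X"
    "variance X / expectation X < 1 \<longleftrightarrow> variance X < expectation X"
    using assms(3) by simp_all
  moreover have "random_variable borel X" using assms(1) by (rule borel_measurable_integrable)
  ultimately show
    "overdispersed X \<longleftrightarrow> expectation (\<lambda>\<omega>. (X \<omega>)\<^sup>2) - expectation X > (expectation X)\<^sup>2"
    "underdispersed X \<longleftrightarrow> expectation (\<lambda>\<omega>. (X \<omega>)\<^sup>2) - expectation X < (expectation X)\<^sup>2"
    using assms(2,3) unfolding overdispersed_def underdispersed_def variance_eq[OF assms(1,2)]
    by (simp_all, linarith+)
qed

theorem proposition7p2:
  fixes \<alpha> \<beta> \<gamma> \<rho> :: real
    and \<phi> V :: "real \<Rightarrow> real"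
    and L :: ereal
    and M :: "'a measure"
    and X :: "'a \<Rightarrow> nat"
  assumes pos: "\<alpha> > 0" "\<beta> > 0" "\<gamma> > 0"
    and \<phi>_V: "admissible_pair \<phi> V"
    and L: "((\<lambda>x. ereal (\<phi> x)) \<longlongrightarrow> L) at_top"
    and \<rho>: "0 < \<rho>" "L \<noteq> \<infinity> \<longrightarrow> \<rho> < real_of_ereal L powr \<alpha>"
    and M: "prob_space M"
    and X: "X \<in> measurable M (count_space UNIV)"
    and pmf_X: "\<And>n. measure M {\<omega> \<in> space M. X \<omega> = n} =
      Gamma (real n + \<gamma>) * \<rho> ^ n / (fact n * V (\<alpha> * real n + \<beta>)) * (1 / Z \<alpha> \<beta> \<gamma> \<rho> V)"
  shows "(prob_space.overdispersed M (\<lambda>\<omega>. real (X \<omega>)) \<longleftrightarrow>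
      Z \<alpha> \<beta> \<gamma> \<rho> V * Z \<alpha> (2 * \<alpha> + \<beta>) (\<gamma> + 2) \<rho> V > (Z \<alpha> (\<alpha> + \<beta>) (\<gamma> + 1) \<rho> V)\<^sup>2) \<and>
    (prob_space.underdispersed M (\<lambda>\<omega>. real (X \<omega>)) \<longleftrightarrow>
      Z \<alpha> \<beta> \<gamma> \<rho> V * Z \<alpha> (2 * \<alpha> + \<beta>) (\<gamma> + 2) \<rho> V < (Z \<alpha> (\<alpha> + \<beta>) (\<gamma> + 1) \<rho> V)\<^sup>2)"
proof -
  interpret prob_space M by (rule M)
  have \<phi>: "\<And>x. x > 0 \<Longrightarrow> \<phi> x > 0" using \<phi>_V by (simp add: admissible_pair_def)
  obtain l where l: "l > 0" "\<rho> < l powr \<alpha>" "eventually (\<lambda>x. l \<le> \<phi> x) at_top"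
    using ex_lower_bound_above_root[OF L pos(1) \<rho> \<phi>] by blast
  note V = admissible_pair_growth[OF \<phi>_V pos(1) l(1,3)]
  have summable: "summable (Z_term \<alpha> b c \<rho> V)" if "b > 0" "c > 0" for b c
    using summable_Z_term[OF V(1) pos(1) that \<rho>(1) l(2) V(2)] .
  have Z_pos: "Z \<alpha> b c \<rho> V > 0" if "b > 0" "c > 0" for b c
    unfolding Z_eq_suminf
    by (intro suminf_pos summable that Z_term_pos V(1) pos(1) \<rho>(1))
  define Z0 where "Z0 = Z \<alpha> \<beta> \<gamma> \<rho> V"
  define Z1 where "Z1 = Z \<alpha> (\<alpha> + \<beta>) (\<gamma> + 1) \<rho> V"
  define Z2 where "Z2 = Z \<alpha> (2 * \<alpha> + \<beta>) (\<gamma> + 2) \<rho> V"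
  have Z: "Z0 > 0" "Z1 > 0" unfolding Z0_def Z1_def using pos by (auto intro!: Z_pos)
  have prob: "prob {\<omega> \<in> space M. X \<omega> = n} = Z_term \<alpha> \<beta> \<gamma> \<rho> V n / Z0" for n
    unfolding pmf_X by (simp add: Z_term_def Z0_def)
  have "summable (Z_term \<alpha> \<beta> \<gamma> \<rho> V)" "summable (Z_term \<alpha> (\<alpha> + \<beta>) (\<gamma> + 1) \<rho> V)"
    "summable (Z_term \<alpha> (2 * \<alpha> + \<beta>) (\<gamma> + 2) \<rho> V)" using pos by (auto intro!: summable)
  note sums = Z_term_moment_sums[OF this, folded Z1_def Z2_def]
  have "(\<lambda>n. real n * prob {\<omega> \<in> space M. X \<omega> = n}) sums (\<rho> * Z1 / Z0)"
    unfolding prob using sums_divide[OF sums(1)] by simp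
  note m1 = expectation_nat_valued[OF X _ this, simplified]
  have "(\<lambda>n. (real n)\<^sup>2 * prob {\<omega> \<in> space M. X \<omega> = n}) sums ((\<rho>\<^sup>2 * Z2 + \<rho> * Z1) / Z0)"
    unfolding prob using sums_divide[OF sums(2)] by simp
  note m2 = expectation_nat_valued[OF X _ this, simplified]
  have "expectation (\<lambda>\<omega>. real (X \<omega>)) > 0" using m1(2) Z \<rho>(1) by simp
  note disp = dispersion_iff_moments[OF m1(1) m2(1) this, unfolded m1(2) m2(2)]
  have gap: "(\<rho>\<^sup>2 * Z2 + \<rho> * Z1) / Z0 - \<rho> * Z1 / Z0 - (\<rho> * Z1 / Z0)\<^sup>2 =
      (\<rho> / Z0)\<^sup>2 * (Z0 * Z2 - Z1\<^sup>2)"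
    using Z by (simp add: field_simps power2_eq_square)
  have sq: "(\<rho> / Z0)\<^sup>2 > 0" using Z \<rho>(1) by simp
  have "(\<rho> * Z1 / Z0)\<^sup>2 < (\<rho>\<^sup>2 * Z2 + \<rho> * Z1) / Z0 - \<rho> * Z1 / Z0 \<longleftrightarrow> Z1\<^sup>2 < Z0 * Z2"
    using zero_less_mult_iff[of "(\<rho> / Z0)\<^sup>2" "Z0 * Z2 - Z1\<^sup>2"] gap sq by linarith
  moreover have "(\<rho>\<^sup>2 * Z2 + \<rho> * Z1) / Z0 - \<rho> * Z1 / Z0 < (\<rho> * Z1 / Z0)\<^sup>2 \<longleftrightarrow> Z0 * Z2 < Z1\<^sup>2"
    using mult_less_0_iff[of "(\<rho> / Z0)\<^sup>2" "Z0 * Z2 - Z1\<^sup>2"] gap sq by linarith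
  ultimately show ?thesis using disp by (simp add: Z0_def Z1_def Z2_def)
qed

end
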